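(* Let $\mathcal{U}_0,\mathcal{V}_0\in S^3$ and $s,t\in[0,\pi]$. Then \[ U(\mathcal{U}_0,s)\otimes U(\mathcal{V}_0,t)= \begin{cases} U(\mathcal{U}_0\mathcal{V}_0,\,s+t) & \text{if } s+t\in[0,\pi],\\ S^3 & \text{if } s+t\in[\pi,2\pi]. \end{cases} \]
   Context: $\mathbb{H}$ denotes the real quaternions, identified with $\mathbb{R}^4$ with its Euclidean inner product $\langle\cdot,\cdot\rangle$, and $S^3\subset\mathbb{H}$ is the set of unit quaternions. For subsets $A,B\subseteq\mathbb{H}$, the Minkowski product is $A\otimes B=\{ab: a\in A,\ b\in B\}$ (quaternion product). For $\mathcal{P}\in S^3$ and $r\in[0,\pi]$, the spherical cap is $U(\mathcal{P},r):=\{\mathcal{U}\in S^3:\langle\mathcal{U},\mathcal{P}\rangle\ge\cos r\}$. *)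

theory Defs
  imports "HOL-Analysis.Analysis" "HOL-Library.Set_Algebras"
begin

datatype quat = Quat (qre: real) (qi: real) (qj: real) (qk: real)

lemma quat_eq_iff: "p = q \<longleftrightarrow> qre p = qre q \<and> qi p = qi q \<and> qj p = qj q \<and> qk p = qk q"
  by (auto intro: quat.expand)

instantiation quat :: real_algebra_1
begin

definition "0 = Quat 0 0 0 0"
definition "1 = Quat 1 0 0 0"
definition "- p = Quat (- qre p) (- qi p) (- qj p) (- qk p)"
definition "p + q = Quat (qre p + qre q) (qi p + qi q) (qj p + qj q) (qk p + qk q)"
definition "p - q = Quat (qre p - qre q) (qi p - qi q) (qj p - qj q) (qk p - qk q)"

(* Hamilton product: i^2 = j^2 = k^2 = ijk = -1 *)
definition
  "p * q = Quat
    (qre p * qre q - qi p * qi q - qj p * qj q - qk p * qk q)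
    (qre p * qi q + qi p * qre q + qj p * qk q - qk p * qj q)
    (qre p * qj q - qi p * qk q + qj p * qre q + qk p * qi q)
    (qre p * qk q + qi p * qj q - qj p * qi q + qk p * qre q)"

definition "c *\<^sub>R q = Quat (c * qre q) (c * qi q) (c * qj q) (c * qk q)"

instance
  by standard
    (simp_all add: quat_eq_iff zero_quat_def one_quat_def uminus_quat_def plus_quat_def
      minus_quat_def times_quat_def scaleR_quat_def algebra_simps)

end

(* Euclidean structure of R^4 in the coordinates (1, i, j, k) *)
instantiation quat :: real_inner
begin

definition "inner p q = qre p * qre q + qi p * qi q + qj p * qj q + qk p * qk q"
definition "norm (q::quat) = sqrt (inner q q)"
definition "dist (p::quat) q = norm (p - q)"
definition "sgn (q::quat) = q /\<^sub>R norm q"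
definition "(uniformity :: (quat \<times> quat) filter) = (INF e\<in>{0 <..}. principal {(x, y). dist x y < e})"
definition "open (U :: quat set) \<longleftrightarrow> (\<forall>x\<in>U. eventually (\<lambda>(x', y). x' = x \<longrightarrow> y \<in> U) uniformity)"

instance
proof
  fix p :: quat
  show "inner p p = 0 \<longleftrightarrow> p = 0"
    by (simp add: inner_quat_def quat_eq_iff zero_quat_def add_nonneg_eq_0_iff)
qed (simp_all add: quat_eq_iff zero_quat_def plus_quat_def minus_quat_def scaleR_quat_def
      inner_quat_def norm_quat_def dist_quat_def sgn_quat_def uniformity_quat_def open_quat_def
      algebra_simps)

end

(* The Minkowski product of sets of quaternions is the set product A * B of Set_Algebras. *)

definition S3 :: "quat set" where
  "S3 = sphere 0 1"

definition cap :: "quat \<Rightarrow> real \<Rightarrow> quat set" where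
  "cap P r = {U \<in> S3. inner U P \<ge> cos r}"

end

theory Submission
  imports Defs
begin

text \<open>
  On the unit sphere the angle \<open>arccos (inner x y)\<close> is a metric, and the cap of radius \<open>r\<close> about
  \<open>P\<close> is its closed ball. Multiplication by a unit quaternion, on either side, is an isometry.
  Since \<open>A * B\<close> differs from \<open>U0 * V0\<close> by a left and a right move,
  \<open>A * B, U0 * B, U0 * V0\<close>, the triangle inequality puts a product of points of the two caps
  within angle \<open>s + t\<close> of \<open>U0 * V0\<close>.

  Conversely, to write \<open>W\<close> as \<open>A * B\<close>, substitute \<open>Z = A * V0\<close>: by the same isometries the
  conditions on \<open>A\<close> and on \<open>B = cnj A * W\<close> say that \<open>Z\<close> lies within \<open>s\<close> of \<open>U0 * V0\<close> and within
  \<open>t\<close> of \<open>W\<close>. Such a \<open>Z\<close> is found on a great circle arc from \<open>U0 * V0\<close> to \<open>W\<close> as soon as the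
  length of that arc is at most \<open>s + t\<close>.

  Hence the product set always consists of the \<open>W\<close> at angle at most \<open>s + t\<close> from \<open>U0 * V0\<close>
  (lemma \<open>cap_times_cap\<close>). The two cases of the theorem only record that this is a cap when
  \<open>s + t \<le> pi\<close> and imposes no condition when \<open>s + t \<ge> pi\<close>, because angles never exceed \<open>pi\<close>.
\<close>

section \<open>Angles between unit vectors\<close>

lemma abs_inner_le_1:
  fixes x y :: "'a::real_inner"
  assumes "norm x = 1" "norm y = 1"
  shows "\<bar>inner x y\<bar> \<le> 1"
  using Cauchy_Schwarz_ineq2[of x y] assms by simp

text \<open>
  Split \<open>x\<close> and \<open>y\<close> into their components along \<open>z\<close> and orthogonal to it. The orthogonal parts have
  norms \<open>sin a\<close> and \<open>sin b\<close>, so Cauchy--Schwarz for them bounds \<open>inner x y\<close> below by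
  \<open>cos a * cos b - sin a * sin b = cos (a + b)\<close>.
\<close>

lemma arccos_inner_triangle:
  fixes x y z :: "'a::real_inner"
  assumes x: "norm x = 1" and y: "norm y = 1" and z: "norm z = 1"
  shows "arccos (inner x y) \<le> arccos (inner x z) + arccos (inner z y)"
proof -
  define a where "a = arccos (inner x z)"
  define b where "b = arccos (inner z y)"
  have xz: "\<bar>inner x z\<bar> \<le> 1" and zy: "\<bar>inner z y\<bar> \<le> 1" and xy: "\<bar>inner x y\<bar> \<le> 1"
    using abs_inner_le_1 x y z by blast+
  have cos_a: "cos a = inner x z" and cos_b: "cos b = inner z y"
    using xz zy by (simp_all add: a_def b_def cos_arccos_abs)
  have a: "0 \<le> a" "a \<le> pi" and b: "0 \<le> b" "b \<le> pi"
    using xz zy by (auto simp: a_def b_def abs_le_iff intro!: arccos_lbound arccos_ubound)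
  have unit: "inner x x = 1" "inner y y = 1" "inner z z = 1"
    using x y z by (simp_all add: norm_eq_1)
  define x' where "x' = x - cos a *\<^sub>R z"
  define y' where "y' = y - cos b *\<^sub>R z"
  have "inner x' x' = (sin a)\<^sup>2"
    unfolding x'_def sin_squared_eq
    by (simp add: inner_diff_left inner_diff_right unit inner_commute[of z x] cos_a[symmetric]
        power2_eq_square algebra_simps)
  then have nx: "norm x' = sin a"
    using a by (simp add: norm_eq_sqrt_inner sin_ge_zero)
  have "inner y' y' = (sin b)\<^sup>2"
    unfolding y'_def sin_squared_eq
    by (simp add: inner_diff_left inner_diff_right unit inner_commute[of y z] cos_b[symmetric]
        power2_eq_square algebra_simps)
  then have ny: "norm y' = sin b"
    using b by (simp add: norm_eq_sqrt_inner sin_ge_zero)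
  have "inner x y = cos a * cos b + inner x' y'"
    unfolding x'_def y'_def
    by (simp add: inner_diff_left inner_diff_right unit cos_a[symmetric] cos_b[symmetric]
        algebra_simps)
  moreover have "- (sin a * sin b) \<le> inner x' y'"
    using Cauchy_Schwarz_ineq2[of x' y'] nx ny by simp
  ultimately have cos_ab: "cos (a + b) \<le> inner x y"
    by (simp add: cos_add)
  have "arccos (inner x y) \<le> a + b"
  proof (cases "a + b \<le> pi")
    case True
    have "arccos (inner x y) \<le> arccos (cos (a + b))"
      using cos_ab xy by (intro arccos_le_arccos) auto
    then show ?thesis
      using True a b by (simp add: arccos_cos)
  next
    case False
    then show ?thesis
      using xy arccos_ubound[of "inner x y"] by (simp add: abs_le_iff)
  qed
  then show ?thesis
    by (simp add: a_def b_def)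
qed

text \<open>
  A unit vector \<open>e\<close> orthogonal to \<open>p\<close> is supplied for the cases \<open>w = p\<close> and \<open>w = - p\<close>, in
  which \<open>w\<close> itself does not determine a direction to leave \<open>p\<close> in. For \<open>w = - p\<close> one must exist:
  in dimension one there is no arc from \<open>p\<close> to \<open>- p\<close>.
\<close>

lemma unit_vector_polar:
  fixes p w e :: "'a::real_inner"
  assumes p: "norm p = 1" and w: "norm w = 1" and e: "norm e = 1" "inner e p = 0"
  obtains n where "norm n = 1" "inner n p = 0"
    "w = cos (arccos (inner w p)) *\<^sub>R p + sin (arccos (inner w p)) *\<^sub>R n"
proof -
  define \<theta> where "\<theta> = arccos (inner w p)"
  have wp: "\<bar>inner w p\<bar> \<le> 1"
    using abs_inner_le_1 w p by blast
  have cos_\<theta>: "cos \<theta> = inner w p"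
    using wp by (simp add: \<theta>_def cos_arccos_abs)
  have sin_nonneg: "0 \<le> sin \<theta>"
    using wp by (auto simp: \<theta>_def abs_le_iff intro!: sin_ge_zero arccos_lbound arccos_ubound)
  have unit: "inner p p = 1" "inner w w = 1"
    using p w by (simp_all add: norm_eq_1)
  define v where "v = w - cos \<theta> *\<^sub>R p"
  have "inner v v = (sin \<theta>)\<^sup>2"
    unfolding v_def sin_squared_eq
    by (simp add: inner_diff_left inner_diff_right unit inner_commute[of p w] cos_\<theta>[symmetric]
        power2_eq_square algebra_simps)
  then have nv: "norm v = sin \<theta>"
    using sin_nonneg by (simp add: norm_eq_sqrt_inner)
  have vp: "inner v p = 0"
    by (simp add: v_def inner_diff_left unit cos_\<theta>)
  show thesis
  proof (cases "sin \<theta> = 0")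
    case True
    then have "w = cos \<theta> *\<^sub>R p + sin \<theta> *\<^sub>R e"
      using nv by (simp add: v_def)
    then show thesis
      using that[of e] e by (simp add: \<theta>_def)
  next
    case False
    define n where "n = v /\<^sub>R sin \<theta>"
    have "norm n = 1" "inner n p = 0"
      using False sin_nonneg nv vp by (simp_all add: n_def)
    moreover have "w = cos \<theta> *\<^sub>R p + sin \<theta> *\<^sub>R n"
      using False by (simp add: n_def v_def)
    ultimately show thesis
      using that[of n] by (simp add: \<theta>_def)
  qed
qed

text \<open>
  Walk from \<open>p\<close> towards \<open>w\<close> along a great circle for a length of \<open>s\<close>, stopping early if \<open>w\<close> is
  reached; what remains of the way has length at most \<open>t\<close>.
\<close>

lemma exists_unit_vector_between:
  fixes p w e :: "'a::real_inner"
  assumes p: "norm p = 1" and w: "norm w = 1" and e: "norm e = 1" "inner e p = 0"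
    and s: "0 \<le> s" and t: "0 \<le> t"
    and st: "arccos (inner w p) \<le> s + t"
  obtains z where "norm z = 1" "arccos (inner z p) \<le> s" "arccos (inner w z) \<le> t"
proof -
  define \<theta> where "\<theta> = arccos (inner w p)"
  obtain n where n: "norm n = 1" "inner n p = 0" and w_eq: "w = cos \<theta> *\<^sub>R p + sin \<theta> *\<^sub>R n"
    using unit_vector_polar[OF p w e] unfolding \<theta>_def by blast
  have \<theta>: "0 \<le> \<theta>" "\<theta> \<le> pi"
    using abs_inner_le_1[OF w p]
    by (auto simp: \<theta>_def abs_le_iff intro!: arccos_lbound arccos_ubound)
  define a where "a = min s \<theta>"
  have a: "0 \<le> a" "a \<le> s" "a \<le> \<theta>" "\<theta> - a \<le> t"
    using s t st \<theta> by (auto simp: a_def \<theta>_def)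
  define z where "z = cos a *\<^sub>R p + sin a *\<^sub>R n"
  have unit: "inner p p = 1" "inner n n = 1" "inner p n = 0"
    using p n by (simp_all add: norm_eq_1 inner_commute)
  have "inner z z = cos a * cos a + sin a * sin a"
    by (simp add: z_def inner_add_left inner_add_right unit n)
  then have "norm z = 1"
    by (simp add: norm_eq_1 sin_cos_squared_add3)
  moreover have "inner z p = cos a"
    by (simp add: z_def inner_add_left unit n)
  then have "arccos (inner z p) \<le> s"
    using a \<theta> by (simp add: arccos_cos)
  moreover have "inner w z = cos (\<theta> - a)"
    by (simp add: w_eq z_def inner_add_left inner_add_right unit n cos_diff)
  then have "arccos (inner w z) \<le> t"
    using a \<theta> by (simp add: arccos_cos)
  ultimately show thesis
    by (rule that)
qed


section \<open>Unit quaternions act by isometries\<close>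

definition qcnj :: "quat \<Rightarrow> quat" where
  "qcnj q = Quat (qre q) (- qi q) (- qj q) (- qk q)"

lemma inner_mult_left_cancel: "inner (a * b) (a * c) = inner a a * inner b c" for a b c :: quat
  by (simp add: inner_quat_def times_quat_def algebra_simps)

lemma inner_mult_right_cancel: "inner (a * c) (b * c) = inner a b * inner c c" for a b c :: quat
  by (simp add: inner_quat_def times_quat_def algebra_simps)

lemma norm_mult_quat: "norm (a * b) = norm a * norm b" for a b :: quat
  by (simp add: norm_eq_sqrt_inner inner_mult_left_cancel real_sqrt_mult)

lemma norm_qcnj [simp]: "norm (qcnj q) = norm q"
  by (simp add: norm_quat_def inner_quat_def qcnj_def)

lemma mult_qcnj: "q * qcnj q = inner q q *\<^sub>R 1"
  by (simp add: quat_eq_iff times_quat_def qcnj_def inner_quat_def scaleR_quat_def one_quat_def)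

text \<open>Multiplication by the conjugate is adjoint to multiplication, on either side.\<close>

lemma inner_qcnj_mult: "inner (qcnj a * w) v = inner w (a * v)"
  by (simp add: inner_quat_def times_quat_def qcnj_def algebra_simps)

lemma inner_mult_qcnj: "inner (z * qcnj v) u = inner z (u * v)"
  by (simp add: inner_quat_def times_quat_def qcnj_def algebra_simps)

text \<open>
  The sphere has a unit tangent field: at \<open>P\<close> the vector \<open>i * P\<close>, since \<open>i\<close> is orthogonal to \<open>1\<close>
  and right multiplication preserves orthogonality.
\<close>

lemma exists_unit_orthogonal_quat:
  fixes P :: quat
  assumes "norm P = 1"
  obtains E :: quat where "norm E = 1" "inner E P = 0"
proof
  show "norm (Quat 0 1 0 0 * P) = 1"
    using assms by (simp add: norm_mult_quat) (simp add: norm_quat_def inner_quat_def)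
  show "inner (Quat 0 1 0 0 * P) P = 0"
    by (simp add: inner_quat_def times_quat_def)
qed


section \<open>Products of spherical caps\<close>

lemma S3_iff: "q \<in> S3 \<longleftrightarrow> norm q = 1"
  by (simp add: S3_def)

lemma cap_eq_arccos:
  assumes "norm P = 1" "0 \<le> r" "r \<le> pi"
  shows "cap P r = {U \<in> S3. arccos (inner U P) \<le> r}"
proof -
  have "cos r \<le> inner U P \<longleftrightarrow> arccos (inner U P) \<le> r" if "U \<in> S3" for U
  proof -
    have "\<bar>inner U P\<bar> \<le> 1"
      using abs_inner_le_1 that assms by (simp add: S3_iff)
    then have "arccos (inner U P) \<le> arccos (cos r) \<longleftrightarrow> cos r \<le> inner U P"
      by (intro arccos_le_mono) auto
    then show ?thesis
      using assms by (simp add: arccos_cos)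
  qed
  then show ?thesis
    by (auto simp: cap_def)
qed

lemma cap_times_cap:
  fixes U0 V0 :: quat
  assumes U0: "norm U0 = 1" and V0: "norm V0 = 1"
    and s: "0 \<le> s" "s \<le> pi" and t: "0 \<le> t" "t \<le> pi"
  shows "cap U0 s * cap V0 t = {W \<in> S3. arccos (inner W (U0 * V0)) \<le> s + t}"
proof (intro equalityI subsetI)
  fix W assume "W \<in> cap U0 s * cap V0 t"
  then obtain A B where W: "W = A * B" and A: "A \<in> cap U0 s" and B: "B \<in> cap V0 t"
    by (auto simp: set_times_def)
  have nA: "norm A = 1" "arccos (inner A U0) \<le> s" and nB: "norm B = 1" "arccos (inner B V0) \<le> t"
    using A B cap_eq_arccos U0 V0 s t by (auto simp: S3_iff)
  have "arccos (inner W (U0 * V0))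
      \<le> arccos (inner (A * B) (U0 * B)) + arccos (inner (U0 * B) (U0 * V0))"
    unfolding W by (rule arccos_inner_triangle) (simp_all add: norm_mult_quat nA nB U0 V0)
  also have "\<dots> = arccos (inner A U0) + arccos (inner B V0)"
    using nB U0 by (simp add: inner_mult_left_cancel inner_mult_right_cancel norm_eq_1)
  also have "\<dots> \<le> s + t"
    using nA nB by simp
  finally show "W \<in> {W \<in> S3. arccos (inner W (U0 * V0)) \<le> s + t}"
    using nA nB by (simp add: W S3_iff norm_mult_quat)
next
  fix W assume "W \<in> {W \<in> S3. arccos (inner W (U0 * V0)) \<le> s + t}"
  then have W: "norm W = 1" and st: "arccos (inner W (U0 * V0)) \<le> s + t"
    by (simp_all add: S3_iff)
  have P: "norm (U0 * V0) = 1"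
    by (simp add: norm_mult_quat U0 V0)
  obtain E :: quat where E: "norm E = 1" "inner E (U0 * V0) = 0"
    using exists_unit_orthogonal_quat[OF P] .
  obtain Z where Z: "norm Z = 1" "arccos (inner Z (U0 * V0)) \<le> s" "arccos (inner W Z) \<le> t"
    using exists_unit_vector_between[OF P W E s(1) t(1) st] .
  \<comment> \<open>\<open>A\<close> solves \<open>A * V0 = Z\<close>, and \<open>B\<close> solves \<open>A * B = W\<close>.\<close>
  define A where "A = Z * qcnj V0"
  define B where "B = qcnj A * W"
  have nA: "norm A = 1"
    by (simp add: A_def norm_mult_quat Z V0)
  have nB: "norm B = 1"
    by (simp add: B_def norm_mult_quat nA W)
  have "inner A U0 = inner Z (U0 * V0)"
    by (simp add: A_def inner_mult_qcnj)
  then have A: "A \<in> cap U0 s"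
    using cap_eq_arccos[OF U0 s] nA Z by (simp add: S3_iff)
  have "qcnj V0 * V0 = 1"
    using V0 by (simp add: norm_eq_1 quat_eq_iff times_quat_def qcnj_def inner_quat_def one_quat_def)
  then have "A * V0 = Z"
    by (simp add: A_def mult.assoc)
  then have "inner B V0 = inner W Z"
    by (simp add: B_def inner_qcnj_mult)
  then have B: "B \<in> cap V0 t"
    using cap_eq_arccos[OF V0 t] nB Z by (simp add: S3_iff)
  have "A * B = (A * qcnj A) * W"
    by (simp add: B_def mult.assoc)
  also have "\<dots> = W"
    using nA by (simp add: mult_qcnj norm_eq_1)
  finally show "W \<in> cap U0 s * cap V0 t"
    using A B by (auto simp: set_times_def)
qed

theorem theorem1:
  fixes U0 V0 :: quat and s t :: real
  assumes "U0 \<in> S3" and "V0 \<in> S3"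
    and "s \<in> {0..pi}" and "t \<in> {0..pi}"
  shows "(s + t \<in> {0..pi} \<longrightarrow> cap U0 s * cap V0 t = cap (U0 * V0) (s + t)) \<and>
         (s + t \<in> {pi..2 * pi} \<longrightarrow> cap U0 s * cap V0 t = S3)"
proof (intro conjI impI)
  have U0: "norm U0 = 1" and V0: "norm V0 = 1"
    using assms by (simp_all add: S3_iff)
  then have P: "norm (U0 * V0) = 1"
    by (simp add: norm_mult_quat)
  have prod: "cap U0 s * cap V0 t = {W \<in> S3. arccos (inner W (U0 * V0)) \<le> s + t}"
    using cap_times_cap[OF U0 V0] assms by simp
  show "cap U0 s * cap V0 t = cap (U0 * V0) (s + t)" if "s + t \<in> {0..pi}"
    using that cap_eq_arccos[OF P] by (simp add: prod)
  show "cap U0 s * cap V0 t = S3" if "s + t \<in> {pi..2 * pi}"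
  proof -
    have "arccos (inner W (U0 * V0)) \<le> s + t" if "W \<in> S3" for W
    proof -
      have "\<bar>inner W (U0 * V0)\<bar> \<le> 1"
        using abs_inner_le_1 that P by (simp add: S3_iff)
      then have "arccos (inner W (U0 * V0)) \<le> pi"
        by (intro arccos_ubound) auto
      then show ?thesis
        using \<open>s + t \<in> {pi..2 * pi}\<close> by simp
    qed
    then show ?thesis
      by (auto simp: prod)
  qed
qed

end
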